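(* Let $v,d\ge1$ be integers and let $\xi^*$ be an $A$-optimal approximate block design for comparisons with a control, i.e. $\xi^*=r^*\otimes s$ for some $s\in\mathbb R^d$ with all $s_k>0$ and $\sum_ks_k=1$, where $$r_0^*=\frac{1}{\sqrt v+1}\quad\text{and}\quad r_i^*=\frac{1}{\sqrt v(\sqrt v+1)}\ \text{ for } i=1,\dots,v.$$ Then $\xi^*$ is also $R$-optimal (among all feasible approximate block designs with the given $v$ and $d$).
   Context: Treatments are labelled $0,1,\dots,v$ ($0$ is the control, the others are test treatments); blocks are labelled $1,\dots,d$. An approximate (block) design is a function $\xi:\{0,\dots,v\}\times\{1,\dots,d\}\to[0,1]$ with $\sum_{i,k}\xi(i,k)=1$ such that $s_k(\xi):=\sum_{i=0}^v\xi(i,k)>0$ for all $k$ (the block sizes are otherwise not fixed). Put $s^{-1}=(s_1^{-1},\dots,s_d^{-1})$, $r_i(\xi)=\sum_k\xi(i,k)$, $r=(r_0,\dots,r_v)^T$, $X(\xi)=(\xi(i,k))_{0\le i\le v,\,1\le k\le d}$, $Z(\xi)=(\xi(i,k))_{1\le i\le v,\,1\le k\le d}$. The product design $r\otimes s$ is the design with $\xi(i,k)=r_is_k$ for all $i,k$. Let $M(\xi)=\mathrm{diag}(r)-X\,\mathrm{diag}(s^{-1})X^T$ and $Q=(-1_v,I_v)^T$ ($1_v$ the all-ones vector). The design is feasible if the column space of $Q$ is contained in that of $M(\xi)$. The information matrix for treatment-control comparisons $\tau_1-\tau_0,\dots,\tau_v-\tau_0$ is the $v\times v$ matrix $$N(\xi)=\mathrm{diag}(r_1,\dots,r_v)-Z\,\mathrm{diag}(s^{-1})Z^T,$$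 nonsingular for feasible $\xi$. A feasible approximate design is $A$-optimal if it minimizes the trace of $N^{-1}(\xi)$, and $R$-optimal if it minimizes $$\Psi_R(N(\xi))=\prod_{i=1}^v(N^{-1}(\xi))_{ii},$$ in each case over all feasible approximate designs with the given $v$ and $d$. It is a known fact that an approximate design is $A$-optimal if and only if it has the product form displayed in the claim. *)

theory Defs
  imports "HOL-Analysis.Analysis"
begin

text \<open>
  The \<open>v\<close> test treatments are the elements of a finite type \<open>'v\<close> and the \<open>d\<close> blocks those of a
  finite type \<open>'d\<close>, so \<open>v = CARD('v) \<ge> 1\<close> and \<open>d = CARD('d) \<ge> 1\<close>. The set of all treatments is
  \<open>'v option\<close>: \<open>None\<close> is the control (label \<open>0\<close>) and \<open>Some i\<close> is the test treatment \<open>i\<close>.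
\<close>

type_synonym ('v, 'd) design = "'v option \<Rightarrow> 'd \<Rightarrow> real"

definition block_size :: "('v::finite, 'd::finite) design \<Rightarrow> 'd \<Rightarrow> real" where
  "block_size \<xi> k = (\<Sum>i\<in>UNIV. \<xi> i k)"

definition replication :: "('v::finite, 'd::finite) design \<Rightarrow> 'v option \<Rightarrow> real" where
  "replication \<xi> i = (\<Sum>k\<in>UNIV. \<xi> i k)"

definition approx_design :: "('v::finite, 'd::finite) design \<Rightarrow> bool" where
  "approx_design \<xi> \<longleftrightarrow>
     (\<forall>i k. 0 \<le> \<xi> i k \<and> \<xi> i k \<le> 1) \<and>
     (\<Sum>i\<in>UNIV. \<Sum>k\<in>UNIV. \<xi> i k) = 1 \<and>
     (\<forall>k. block_size \<xi> k > 0)"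

definition product_design :: "('v option \<Rightarrow> real) \<Rightarrow> ('d \<Rightarrow> real) \<Rightarrow> ('v, 'd) design" where
  "product_design r s = (\<lambda>i k. r i * s k)"

definition diag_mat :: "('n \<Rightarrow> real) \<Rightarrow> real ^ 'n ^ 'n" where
  "diag_mat f = (\<chi> i j. if i = j then f i else 0)"

definition X_mat :: "('v::finite, 'd::finite) design \<Rightarrow> real ^ 'd ^ 'v option" where
  "X_mat \<xi> = (\<chi> i k. \<xi> i k)"

definition Z_mat :: "('v::finite, 'd::finite) design \<Rightarrow> real ^ 'd ^ 'v" where
  "Z_mat \<xi> = (\<chi> i k. \<xi> (Some i) k)"

definition M_mat :: "('v::finite, 'd::finite) design \<Rightarrow> real ^ 'v option ^ 'v option" where
  "M_mat \<xi> = diag_mat (replication \<xi>) -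
     X_mat \<xi> ** diag_mat (\<lambda>k. inverse (block_size \<xi> k)) ** transpose (X_mat \<xi>)"

definition N_mat :: "('v::finite, 'd::finite) design \<Rightarrow> real ^ 'v ^ 'v" where
  "N_mat \<xi> = diag_mat (\<lambda>i. replication \<xi> (Some i)) -
     Z_mat \<xi> ** diag_mat (\<lambda>k. inverse (block_size \<xi> k)) ** transpose (Z_mat \<xi>)"

text \<open>The matrix \<open>Q = (-1, I)\<^sup>T\<close>, whose columns give the contrasts \<open>\<tau>\<^sub>j - \<tau>\<^sub>0\<close>.\<close>

definition Q_mat :: "real ^ 'v ^ 'v::finite option" where
  "Q_mat = (\<chi> i j. case i of None \<Rightarrow> -1 | Some i' \<Rightarrow> if i' = j then 1 else 0)"

definition feasible :: "('v::finite, 'd::finite) design \<Rightarrow> bool" where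
  "feasible \<xi> \<longleftrightarrow>
     span (columns (Q_mat :: real ^ 'v ^ 'v option)) \<subseteq> span (columns (M_mat \<xi>))"

text \<open>
  Both criteria are meaningful for feasible designs only, for which \<open>N_mat\<close> is nonsingular;
  \<^const>\<open>matrix_inv\<close> is unspecified on singular matrices.
\<close>

definition A_criterion :: "('v::finite, 'd::finite) design \<Rightarrow> real" where
  "A_criterion \<xi> = trace (matrix_inv (N_mat \<xi>))"

definition R_criterion :: "('v::finite, 'd::finite) design \<Rightarrow> real" where
  "R_criterion \<xi> = (\<Prod>i\<in>UNIV. matrix_inv (N_mat \<xi>) $ i $ i)"

text \<open>The competing designs have the same type, hence the same \<open>v\<close> and \<open>d\<close>.\<close>

definition A_optimal :: "('v::finite, 'd::finite) design \<Rightarrow> bool" where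
  "A_optimal \<xi> \<longleftrightarrow> approx_design \<xi> \<and> feasible \<xi> \<and>
     (\<forall>\<eta> :: ('v, 'd) design. approx_design \<eta> \<and> feasible \<eta> \<longrightarrow> A_criterion \<xi> \<le> A_criterion \<eta>)"

definition R_optimal :: "('v::finite, 'd::finite) design \<Rightarrow> bool" where
  "R_optimal \<xi> \<longleftrightarrow> approx_design \<xi> \<and> feasible \<xi> \<and>
     (\<forall>\<eta> :: ('v, 'd) design. approx_design \<eta> \<and> feasible \<eta> \<longrightarrow> R_criterion \<xi> \<le> R_criterion \<eta>)"

definition A_optimal_form :: "('v::finite, 'd::finite) design \<Rightarrow> bool" where
  "A_optimal_form \<xi> \<longleftrightarrow> (\<exists>r s. \<xi> = product_design r s \<and>
     (\<forall>k. s k > 0) \<and> (\<Sum>k\<in>UNIV. s k) = 1 \<and>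
     r None = 1 / (sqrt (real CARD('v)) + 1) \<and>
     (\<forall>i. r (Some i) = 1 / (sqrt (real CARD('v)) * (sqrt (real CARD('v)) + 1))))"

end

theory Submission
  imports Defs
begin

text \<open>
  Write \<open>h\<^sub>i = (N\<^sup>-\<^sup>1)\<^sub>i\<^sub>i\<close>, \<open>q = \<surd>v\<close>. The theorem rests on bounding each \<open>1/h\<^sub>i\<close> from above by a
  quantity that is \<^emph>\<open>linear\<close> in the design, and on the arithmetic-geometric mean inequality, which
  is sharp because all \<open>h\<^sub>i\<close> coincide at the optimum.

  For a positive semidefinite nonsingular \<open>N\<close>, the Cauchy-Schwarz inequality in the form \<open>N\<close> gives
  \<open>1/h\<^sub>i \<le> y\<^sup>T N y\<close> for every \<open>y\<close> with \<open>y\<^sub>i = 1\<close> (lemma \<open>diagonal_of_inverse_ge\<close>). Extending \<open>y\<close>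
  by \<open>0\<close> at the control, \<open>y\<^sup>T N y\<close> is the within-block sum of squares of \<open>y\<close>, so it only grows when
  the block means are replaced by arbitrary constants (lemma \<open>sum_squares_about_constants\<close>). Taking
  the vector \<open>y\<close> that is optimal for the product design, \<open>y\<^sub>j = 1/(q+1)\<close> for \<open>j \<noteq> i\<close>, and the constant
  \<open>1/(q+1)\<close> in all blocks, only the observations on the treatments \<open>i\<close> and \<open>0\<close> contribute:
  \<open>1/h\<^sub>i \<le> (q\<^sup>2 r\<^sub>i + r\<^sub>0)/(q+1)\<^sup>2\<close>. Since \<open>v = q\<^sup>2\<close> and the replications add up to one, the sum over \<open>i\<close>
  of the right-hand sides is \<open>v/(q+1)\<^sup>2\<close> whatever the design, and the arithmetic-geometric mean
  inequality yields \<open>\<Prod> h\<^sub>i \<ge> (q+1)\<^sup>2\<^sup>v\<close> (lemma \<open>R_criterion_ge\<close>).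

  The product design with replications \<open>r\<^sup>*\<close> has \<open>h\<^sub>i = 1/r\<^sup>*\<^sub>i + 1/r\<^sup>*\<^sub>0 = (q+1)\<^sup>2\<close> for all \<open>i\<close>, hence
  attains the bound. An \<open>A\<close>-optimal design attains it as well: the trace of its \<open>N\<^sup>-\<^sup>1\<close> is at most
  the trace \<open>v (q+1)\<^sup>2\<close> of the product design, and a second use of the arithmetic-geometric mean
  inequality, now for the \<open>h\<^sub>i\<close> themselves, gives \<open>\<Prod> h\<^sub>i \<le> (q+1)\<^sup>2\<^sup>v\<close>.
\<close>

section \<open>Sums, products and diagonal entries of an inverse\<close>

lemma sum_UNIV_option:
  fixes f :: "'a::finite option \<Rightarrow> 'b::comm_monoid_add"
  shows "sum f UNIV = f None + (\<Sum>i\<in>UNIV. f (Some i))"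
  by (simp add: UNIV_option_conv sum.reindex)

lemma prod_le_power_of_sum_le:
  fixes x :: "'a::finite \<Rightarrow> real"
  assumes nonneg: "\<And>i. 0 \<le> x i" and sum: "(\<Sum>i\<in>UNIV. x i) \<le> real CARD('a) * c"
  shows "(\<Prod>i\<in>UNIV. x i) \<le> c ^ CARD('a)"
proof -
  let ?n = "CARD('a)"
  have n: "real ?n > 0" by (simp add: card_gt_0_iff)
  let ?P = "\<Prod>i\<in>UNIV. x i"
  have P: "0 \<le> ?P" using nonneg by (simp add: prod_nonneg)
  have "?P powr (1 / ?n) \<le> (\<Sum>i\<in>UNIV. x i / ?n)"
    using nonneg by (intro arith_geom_mean) auto
  also have "\<dots> \<le> c"
    using sum n by (simp add: sum_divide_distrib[symmetric] divide_le_eq mult.commute)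
  finally have le: "?P powr (1 / ?n) \<le> c" .
  have "p = (p powr (1 / ?n)) ^ ?n" if "0 \<le> p" for p :: real
    using that n by (cases "p = 0") (auto simp: powr_power)
  from this[OF P] have "?P = (?P powr (1 / ?n)) ^ ?n" .
  also have "\<dots> \<le> c ^ ?n"
    using le by (intro power_mono) auto
  finally show ?thesis .
qed

lemma matrix_inv_mult:
  fixes A :: "real ^ 'n ^ 'n"
  assumes "invertible A"
  shows "A ** matrix_inv A = mat 1" "matrix_inv A ** A = mat 1"
proof -
  have "A ** matrix_inv A = mat 1 \<and> matrix_inv A ** A = mat 1"
    unfolding matrix_inv_def by (rule someI_ex) (use assms in \<open>simp add: invertible_def\<close>)
  then show "A ** matrix_inv A = mat 1" "matrix_inv A ** A = mat 1" by auto
qed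

lemma matrix_inv_eqI:
  fixes A B :: "real ^ 'n ^ 'n"
  assumes "A ** B = mat 1"
  shows "matrix_inv A = B"
proof -
  have "invertible A" using assms invertible_right_inverse by blast
  then have "matrix_inv A = matrix_inv A ** (A ** B)" using assms by simp
  also have "\<dots> = (matrix_inv A ** A) ** B" by (rule matrix_mul_assoc)
  finally show ?thesis using matrix_inv_mult(2)[OF \<open>invertible A\<close>] by simp
qed

text \<open>
  The column \<open>z = A\<^sup>-\<^sup>1 e\<^sub>i\<close> represents the \<open>i\<close>-th coordinate in the form \<open>A\<close>: \<open>y\<^sub>i = y\<^sup>T A z\<close> and
  \<open>z\<^sup>T A z = z\<^sub>i = (A\<^sup>-\<^sup>1)\<^sub>i\<^sub>i\<close>. Cauchy-Schwarz for \<open>A\<close>, obtained by expanding the form at \<open>y - t z\<close>,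
  gives the bound.
\<close>

lemma diagonal_of_inverse_ge:
  fixes A :: "real ^ 'n ^ 'n"
  assumes inv: "invertible A" and sym: "transpose A = A"
    and psd: "\<And>x. 0 \<le> x \<bullet> (A *v x)"
    and y: "y $ i = 1"
  shows "0 < matrix_inv A $ i $ i" "1 / (matrix_inv A $ i $ i) \<le> y \<bullet> (A *v y)"
proof -
  define z where "z = matrix_inv A *v axis i 1"
  define h where "h = matrix_inv A $ i $ i"
  have zi: "z $ i = h"
    by (simp add: z_def h_def matrix_vector_mul_component inner_axis)
  have Az: "A *v z = axis i 1"
    using matrix_inv_mult(1)[OF inv] by (simp add: z_def matrix_vector_mul_assoc)
  have zA: "z \<bullet> (A *v x) = x $ i" for x
  proof -
    have "z \<bullet> (A *v x) = (z v* A) \<bullet> x" by (simp add: dot_lmul_matrix)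
    also have "z v* A = A *v z" by (metis sym transpose_matrix_vector)
    finally show ?thesis by (simp add: Az inner_axis')
  qed
  have expand: "0 \<le> y \<bullet> (A *v y) - 2 * t + t\<^sup>2 * h" for t :: real
  proof -
    have "(y - t *\<^sub>R z) \<bullet> (A *v (y - t *\<^sub>R z)) = y \<bullet> (A *v y) - 2 * t + t\<^sup>2 * h"
      using zi y by (simp add: matrix_vector_mult_diff_distrib matrix_vector_mult_scaleR
          inner_diff_left inner_diff_right zA Az inner_axis power2_eq_square algebra_simps)
    then show ?thesis using psd[of "y - t *\<^sub>R z"] by simp
  qed
  have "0 \<le> h" using psd[of z] zi by (simp add: zA)
  moreover have "h \<noteq> 0"
    using expand[of "(y \<bullet> (A *v y) + 1) / 2"] by auto
  ultimately have h: "0 < h" by simp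
  then show "0 < matrix_inv A $ i $ i" by (simp add: h_def)
  have "1 / h \<le> y \<bullet> (A *v y)"
    using expand[of "1 / h"] h by (simp add: power2_eq_square)
  then show "1 / (matrix_inv A $ i $ i) \<le> y \<bullet> (A *v y)" by (simp add: h_def)
qed

section \<open>The information matrix as a within-block sum of squares\<close>

lemma weighted_gram_entry:
  fixes X :: "real ^ 'd::finite ^ 'n"
  shows "(X ** diag_mat f ** transpose X) $ i $ j = (\<Sum>k\<in>UNIV. f k * X $ i $ k * X $ j $ k)"
  by (simp add: matrix_matrix_mult_def diag_mat_def transpose_def if_distrib mult_ac cong: if_cong)

lemma M_mat_entry:
  "M_mat \<xi> $ i $ j = (if i = j then replication \<xi> i else 0)
     - (\<Sum>k\<in>UNIV. \<xi> i k * \<xi> j k / block_size \<xi> k)"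
  by (simp add: M_mat_def weighted_gram_entry X_mat_def) (simp add: diag_mat_def field_simps)

lemma N_mat_entry:
  "N_mat \<xi> $ i $ j = M_mat \<xi> $ Some i $ Some j"
  unfolding M_mat_entry
  by (simp add: N_mat_def weighted_gram_entry Z_mat_def) (simp add: diag_mat_def field_simps)

lemma M_mat_commute: "M_mat \<xi> $ i $ j = M_mat \<xi> $ j $ i"
  by (simp add: M_mat_entry mult.commute)

lemma transpose_N_mat: "transpose (N_mat \<xi>) = N_mat \<xi>"
  by (simp add: vec_eq_iff transpose_def N_mat_entry M_mat_commute)

lemma M_mat_row_sum:
  assumes "\<And>k. block_size \<xi> k > 0"
  shows "(\<Sum>j\<in>UNIV. M_mat \<xi> $ i $ j) = 0"
proof -
  have "(\<Sum>j\<in>UNIV. \<Sum>k\<in>UNIV. \<xi> i k * \<xi> j k / block_size \<xi> k)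
      = (\<Sum>k\<in>UNIV. \<Sum>j\<in>UNIV. \<xi> i k * \<xi> j k / block_size \<xi> k)"
    by (rule sum.swap)
  also have "\<dots> = (\<Sum>k\<in>UNIV. \<xi> i k * block_size \<xi> k / block_size \<xi> k)"
    by (simp add: block_size_def[of \<xi>] sum_distrib_left sum_divide_distrib)
  also have "\<dots> = replication \<xi> i"
    using assms by (simp add: replication_def less_imp_neq[symmetric])
  finally show ?thesis by (simp add: M_mat_entry sum_subtractf)
qed

definition extend_by_zero :: "real ^ 'v \<Rightarrow> 'v option \<Rightarrow> real" where
  "extend_by_zero y i = (case i of None \<Rightarrow> 0 | Some j \<Rightarrow> y $ j)"

lemma extend_by_zero_simps [simp]:
  "extend_by_zero y None = 0" "extend_by_zero y (Some j) = y $ j"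
  by (simp_all add: extend_by_zero_def)

definition block_total :: "('v::finite, 'd::finite) design \<Rightarrow> real ^ 'v \<Rightarrow> 'd \<Rightarrow> real" where
  "block_total \<xi> y k = (\<Sum>i\<in>UNIV. \<xi> i k * extend_by_zero y i)"

lemma block_total_test: "block_total \<xi> y k = (\<Sum>i\<in>UNIV. \<xi> (Some i) k * y $ i)"
  by (simp add: block_total_def sum_UNIV_option)

lemma N_mat_quadratic_form:
  "y \<bullet> (N_mat \<xi> *v y) = (\<Sum>k\<in>UNIV. (\<Sum>i\<in>UNIV. \<xi> i k * (extend_by_zero y i)\<^sup>2)
      - (block_total \<xi> y k)\<^sup>2 / block_size \<xi> k)"
proof -
  have 1: "(\<Sum>i\<in>UNIV. \<Sum>j\<in>UNIV. y $ i * ((if i = j then replication \<xi> (Some i) else 0) * y $ j))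
      = (\<Sum>k\<in>UNIV. \<Sum>i\<in>UNIV. \<xi> i k * (extend_by_zero y i)\<^sup>2)"
  proof -
    have "(\<Sum>i\<in>UNIV. \<Sum>j\<in>UNIV. y $ i * ((if i = j then replication \<xi> (Some i) else 0) * y $ j))
        = (\<Sum>i\<in>UNIV. replication \<xi> (Some i) * (y $ i)\<^sup>2)"
      by (simp add: if_distrib if_distribR power2_eq_square mult_ac cong: if_cong)
    also have "\<dots> = (\<Sum>k\<in>UNIV. \<Sum>i\<in>UNIV. \<xi> (Some i) k * (y $ i)\<^sup>2)"
      unfolding replication_def sum_distrib_right by (rule sum.swap)
    finally show ?thesis by (simp add: sum_UNIV_option)
  qed
  have 2: "(\<Sum>i\<in>UNIV. \<Sum>j\<in>UNIV.
        y $ i * ((\<Sum>k\<in>UNIV. \<xi> (Some i) k * \<xi> (Some j) k / block_size \<xi> k) * y $ j))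
      = (\<Sum>k\<in>UNIV. (block_total \<xi> y k)\<^sup>2 / block_size \<xi> k)"
  proof -
    have "(\<Sum>i\<in>UNIV. \<Sum>j\<in>UNIV.
          y $ i * ((\<Sum>k\<in>UNIV. \<xi> (Some i) k * \<xi> (Some j) k / block_size \<xi> k) * y $ j))
        = (\<Sum>i\<in>UNIV. \<Sum>j\<in>UNIV. \<Sum>k\<in>UNIV.
          (\<xi> (Some i) k * y $ i) * (\<xi> (Some j) k * y $ j) / block_size \<xi> k)"
      by (simp add: sum_distrib_left sum_distrib_right mult_ac)
    also have "\<dots> = (\<Sum>i\<in>UNIV. \<Sum>k\<in>UNIV. \<Sum>j\<in>UNIV.
          (\<xi> (Some i) k * y $ i) * (\<xi> (Some j) k * y $ j) / block_size \<xi> k)"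
      by (intro sum.cong refl sum.swap)
    also have "\<dots> = (\<Sum>k\<in>UNIV. \<Sum>i\<in>UNIV. \<Sum>j\<in>UNIV.
          (\<xi> (Some i) k * y $ i) * (\<xi> (Some j) k * y $ j) / block_size \<xi> k)"
      by (rule sum.swap)
    also have "\<dots> = (\<Sum>k\<in>UNIV. (block_total \<xi> y k)\<^sup>2 / block_size \<xi> k)"
      by (simp add: block_total_test power2_eq_square sum_product sum_divide_distrib)
    finally show ?thesis .
  qed
  have "y \<bullet> (N_mat \<xi> *v y) = (\<Sum>i\<in>UNIV. \<Sum>j\<in>UNIV. y $ i * (N_mat \<xi> $ i $ j * y $ j))"
    by (simp add: inner_vec_def matrix_vector_mult_def sum_distrib_left)
  also have "\<dots> =
      (\<Sum>i\<in>UNIV. \<Sum>j\<in>UNIV. y $ i * ((if i = j then replication \<xi> (Some i) else 0) * y $ j))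
      - (\<Sum>i\<in>UNIV. \<Sum>j\<in>UNIV.
          y $ i * ((\<Sum>k\<in>UNIV. \<xi> (Some i) k * \<xi> (Some j) k / block_size \<xi> k) * y $ j))"
    by (simp only: N_mat_entry M_mat_entry option.inject left_diff_distrib right_diff_distrib
        sum_subtractf)
  finally show ?thesis by (simp only: 1 2 sum_subtractf)
qed

text \<open>
  The decomposition of a sum of squares about \<open>c\<^sub>k\<close> into the sum of squares about the block mean
  and the squared bias. It makes the quadratic form easy to bound from above (any choice of \<open>c\<close>)
  and from below (the block means as \<open>c\<close>).
\<close>

lemma sum_squares_about_constants:
  assumes "\<And>k. block_size \<xi> k > 0"
  shows "(\<Sum>k\<in>UNIV. \<Sum>i\<in>UNIV. \<xi> i k * (extend_by_zero y i - c k)\<^sup>2) =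
    y \<bullet> (N_mat \<xi> *v y) + (\<Sum>k\<in>UNIV. block_size \<xi> k * (c k - block_total \<xi> y k / block_size \<xi> k)\<^sup>2)"
proof -
  have "(\<Sum>i\<in>UNIV. \<xi> i k * (extend_by_zero y i - c k)\<^sup>2) =
      ((\<Sum>i\<in>UNIV. \<xi> i k * (extend_by_zero y i)\<^sup>2) - (block_total \<xi> y k)\<^sup>2 / block_size \<xi> k)
      + block_size \<xi> k * (c k - block_total \<xi> y k / block_size \<xi> k)\<^sup>2" for k
  proof -
    have "(\<Sum>i\<in>UNIV. \<xi> i k * (extend_by_zero y i - c k)\<^sup>2) =
        (\<Sum>i\<in>UNIV. \<xi> i k * (extend_by_zero y i)\<^sup>2 - 2 * c k * (\<xi> i k * extend_by_zero y i)
          + (c k)\<^sup>2 * \<xi> i k)"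
      by (rule sum.cong) (auto simp: power2_eq_square algebra_simps)
    also have "\<dots> = (\<Sum>i\<in>UNIV. \<xi> i k * (extend_by_zero y i)\<^sup>2) - 2 * c k * block_total \<xi> y k
        + (c k)\<^sup>2 * block_size \<xi> k"
      by (simp add: sum.distrib sum_subtractf block_total_def block_size_def sum_distrib_left)
    also have "\<dots> = ((\<Sum>i\<in>UNIV. \<xi> i k * (extend_by_zero y i)\<^sup>2)
          - (block_total \<xi> y k)\<^sup>2 / block_size \<xi> k)
        + block_size \<xi> k * (c k - block_total \<xi> y k / block_size \<xi> k)\<^sup>2"
      using assms[of k] by (simp add: power2_eq_square field_simps)
    finally show ?thesis .
  qed
  then show ?thesis by (simp add: N_mat_quadratic_form sum.distrib)
qed

lemma N_mat_quadratic_form_nonneg: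
  assumes "approx_design \<xi>"
  shows "0 \<le> y \<bullet> (N_mat \<xi> *v y)"
proof -
  have "y \<bullet> (N_mat \<xi> *v y) = (\<Sum>k\<in>UNIV. \<Sum>i\<in>UNIV.
      \<xi> i k * (extend_by_zero y i - block_total \<xi> y k / block_size \<xi> k)\<^sup>2)"
    using sum_squares_about_constants[of \<xi> y "\<lambda>k. block_total \<xi> y k / block_size \<xi> k"] assms
    by (simp add: approx_design_def)
  then show ?thesis using assms by (simp add: approx_design_def sum_nonneg)
qed

lemma N_mat_quadratic_form_le:
  assumes "approx_design \<xi>"
  shows "y \<bullet> (N_mat \<xi> *v y) \<le> (\<Sum>i\<in>UNIV. replication \<xi> i * (extend_by_zero y i - c)\<^sup>2)"
proof -
  have "0 \<le> (\<Sum>k\<in>UNIV. block_size \<xi> k * (c - block_total \<xi> y k / block_size \<xi> k)\<^sup>2)"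
    using assms by (simp add: approx_design_def sum_nonneg less_imp_le)
  then have "y \<bullet> (N_mat \<xi> *v y) \<le> (\<Sum>k\<in>UNIV. \<Sum>i\<in>UNIV. \<xi> i k * (extend_by_zero y i - c)\<^sup>2)"
    using sum_squares_about_constants[of \<xi> y "\<lambda>_. c"] assms by (simp add: approx_design_def)
  also have "\<dots> = (\<Sum>i\<in>UNIV. replication \<xi> i * (extend_by_zero y i - c)\<^sup>2)"
    unfolding replication_def sum_distrib_right by (rule sum.swap)
  finally show ?thesis .
qed

text \<open>
  Because the rows of \<open>M\<close> add up to zero, a null vector of \<open>N\<close> extended by \<open>0\<close> is a null vector of
  the symmetric matrix \<open>M\<close>, hence orthogonal to the column space of \<open>M\<close>. Feasibility makes it
  orthogonal to the columns \<open>e\<^sub>j - e\<^sub>0\<close> of \<open>Q\<close>, whose inner products with it are its coordinates.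
\<close>

lemma invertible_N_mat:
  fixes \<xi> :: "('v::finite, 'd::finite) design"
  assumes "approx_design \<xi>" "feasible \<xi>"
  shows "invertible (N_mat \<xi>)"
proof -
  have "y = 0" if "N_mat \<xi> *v y = 0" for y
  proof -
    define w :: "real ^ 'v option" where "w = (\<chi> i. extend_by_zero y i)"
    have Ny: "(\<Sum>i\<in>UNIV. y $ i * M_mat \<xi> $ Some i $ Some j) = 0" for j
    proof -
      have "(\<Sum>i\<in>UNIV. y $ i * M_mat \<xi> $ Some i $ Some j) = (N_mat \<xi> *v y) $ j"
        by (simp add: matrix_vector_mult_def N_mat_entry M_mat_commute[of \<xi> _ "Some j"] mult.commute)
      then show ?thesis using that by simp
    qed
    have "M_mat \<xi> $ Some i $ None = - (\<Sum>j\<in>UNIV. M_mat \<xi> $ Some i $ Some j)" for i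
      using M_mat_row_sum[of \<xi> "Some i"] assms(1) by (simp add: approx_design_def sum_UNIV_option)
    then have "(\<Sum>i\<in>UNIV. y $ i * M_mat \<xi> $ Some i $ None)
        = - (\<Sum>i\<in>UNIV. \<Sum>j\<in>UNIV. y $ i * M_mat \<xi> $ Some i $ Some j)"
      by (simp add: sum_negf sum_distrib_left)
    also have "\<dots> = - (\<Sum>j\<in>UNIV. \<Sum>i\<in>UNIV. y $ i * M_mat \<xi> $ Some i $ Some j)"
      by (subst sum.swap) simp
    finally have Ny0: "(\<Sum>i\<in>UNIV. y $ i * M_mat \<xi> $ Some i $ None) = 0"
      by (simp add: Ny)
    have "w \<bullet> column j (M_mat \<xi>) = 0" for j
      by (cases j) (simp_all add: w_def inner_vec_def column_def sum_UNIV_option Ny Ny0)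
    then have "columns (M_mat \<xi>) \<subseteq> {x. w \<bullet> x = 0}"
      by (auto simp: columns_def)
    then have "span (columns (M_mat \<xi>)) \<subseteq> {x. w \<bullet> x = 0}"
      by (rule span_minimal) (rule subspace_hyperplane)
    moreover have "column j (Q_mat :: real ^ 'v ^ 'v option) \<in> span (columns (M_mat \<xi>))" for j
      using assms(2) span_base[of "column j (Q_mat :: real ^ 'v ^ 'v option)" "columns Q_mat"]
      unfolding feasible_def columns_def by blast
    ultimately have "w \<bullet> column j (Q_mat :: real ^ 'v ^ 'v option) = 0" for j
      by blast
    moreover have "w \<bullet> column j (Q_mat :: real ^ 'v ^ 'v option) = y $ j" for j
      by (simp add: w_def inner_vec_def column_def sum_UNIV_option Q_mat_def if_distrib cong: if_cong)
    ultimately show "y = 0" by (simp add: vec_eq_iff)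
  qed
  then show ?thesis
    using matrix_left_invertible_ker[of "N_mat \<xi>"] invertible_left_inverse by blast
qed

section \<open>The lower bound for the R-criterion\<close>

lemma sum_replication:
  assumes "approx_design \<xi>"
  shows "replication \<xi> None + (\<Sum>i\<in>UNIV. replication \<xi> (Some i)) = 1"
  using assms sum_UNIV_option[of "replication \<xi>"] by (simp add: approx_design_def replication_def)

lemma diag_N_mat_inv:
  fixes \<xi> :: "('v::finite, 'd::finite) design"
  defines "q \<equiv> sqrt (real CARD('v))"
  assumes "approx_design \<xi>" "feasible \<xi>"
  shows "0 < matrix_inv (N_mat \<xi>) $ i $ i"
    and "1 / (matrix_inv (N_mat \<xi>) $ i $ i)
      \<le> (q\<^sup>2 * replication \<xi> (Some i) + replication \<xi> None) / (q + 1)\<^sup>2"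
proof -
  \<comment> \<open>\<open>y\<close> is the column \<open>i\<close> of the inverse information matrix of the optimal product design,
    scaled so that \<open>y\<^sub>i = 1\<close>; the vector extended by \<open>0\<close> has mean \<open>1/(q+1)\<close> in each block of that design.\<close>
  define c where "c = 1 / (q + 1)"
  define y :: "real ^ 'v" where "y = (\<chi> j. if j = i then 1 else c)"
  have q: "q \<ge> 0" by (simp add: q_def)
  have y: "y $ i = 1" by (simp add: y_def)
  note bound = diagonal_of_inverse_ge[OF invertible_N_mat[OF assms(2,3)] transpose_N_mat
      N_mat_quadratic_form_nonneg[OF assms(2)] y]
  show "0 < matrix_inv (N_mat \<xi>) $ i $ i" by (rule bound(1))
  have "1 / (matrix_inv (N_mat \<xi>) $ i $ i) \<le> y \<bullet> (N_mat \<xi> *v y)" by (rule bound(2))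
  also have "\<dots> \<le> (\<Sum>j\<in>UNIV. replication \<xi> j * (extend_by_zero y j - c)\<^sup>2)"
    by (rule N_mat_quadratic_form_le[OF assms(2)])
  also have "\<dots> = replication \<xi> None * c\<^sup>2 + (\<Sum>j\<in>UNIV. if j = i then replication \<xi> (Some j) * (1 - c)\<^sup>2 else 0)"
    unfolding sum_UNIV_option by (intro arg_cong2[where f = "(+)"] sum.cong) (auto simp: y_def)
  also have "\<dots> = replication \<xi> None * c\<^sup>2 + replication \<xi> (Some i) * (1 - c)\<^sup>2"
    by simp
  also have "1 - c = q / (q + 1)" using q by (simp add: c_def field_simps)
  finally show "1 / (matrix_inv (N_mat \<xi>) $ i $ i)
      \<le> (q\<^sup>2 * replication \<xi> (Some i) + replication \<xi> None) / (q + 1)\<^sup>2"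
    by (simp add: c_def power_divide add_divide_distrib mult.commute add.commute)
qed

lemma R_criterion_ge:
  fixes \<xi> :: "('v::finite, 'd::finite) design"
  defines "q \<equiv> sqrt (real CARD('v))"
  assumes "approx_design \<xi>" "feasible \<xi>"
  shows "((q + 1)\<^sup>2) ^ CARD('v) \<le> R_criterion \<xi>"
proof -
  let ?h = "\<lambda>i. matrix_inv (N_mat \<xi>) $ i $ i"
  note diag = diag_N_mat_inv[OF assms(2,3), folded q_def]
  have q: "q \<ge> 0" and q2: "q\<^sup>2 = real CARD('v)" by (simp_all add: q_def)
  have "(\<Sum>i\<in>UNIV. 1 / ?h i)
      \<le> (\<Sum>i\<in>UNIV. (q\<^sup>2 * replication \<xi> (Some i) + replication \<xi> None) / (q + 1)\<^sup>2)"
    by (intro sum_mono diag(2))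
  also have "\<dots> = real CARD('v) *
      (replication \<xi> None + (\<Sum>i\<in>UNIV. replication \<xi> (Some i))) / (q + 1)\<^sup>2"
    by (simp add: sum_divide_distrib[symmetric] sum.distrib sum_distrib_left[symmetric] q2
        distrib_left add.commute)
  finally have "(\<Sum>i\<in>UNIV. 1 / ?h i) \<le> real CARD('v) * (1 / (q + 1)\<^sup>2)"
    by (simp add: sum_replication[OF assms(2)])
  then have "(\<Prod>i\<in>UNIV. 1 / ?h i) \<le> (1 / (q + 1)\<^sup>2) ^ CARD('v)"
    using diag(1) by (intro prod_le_power_of_sum_le) (auto intro: less_imp_le)
  then have "1 / R_criterion \<xi> \<le> 1 / ((q + 1)\<^sup>2) ^ CARD('v)"
    by (simp add: R_criterion_def prod_dividef power_one_over)
  moreover have "0 < R_criterion \<xi>"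
    unfolding R_criterion_def by (intro prod_pos) (simp add: diag(1))
  moreover have "0 < ((q + 1)\<^sup>2) ^ CARD('v)"
    using q by (simp add: add_nonneg_pos)
  ultimately show ?thesis by (simp add: divide_simps split: if_splits)
qed

section \<open>Product designs\<close>

locale positive_product_design =
  fixes r :: "'v::finite option \<Rightarrow> real" and s :: "'d::finite \<Rightarrow> real"
  assumes r_pos: "0 < r i" and s_pos: "0 < s k"
    and sum_r: "(\<Sum>i\<in>UNIV. r i) = 1" and sum_s: "(\<Sum>k\<in>UNIV. s k) = 1"
begin

lemma block_size_product: "block_size (product_design r s) k = s k"
  by (simp add: block_size_def product_design_def sum_distrib_right[symmetric] sum_r)

lemma replication_product: "replication (product_design r s) i = r i"
  by (simp add: replication_def product_design_def sum_distrib_left[symmetric] sum_s)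

lemma approx_design_product: "approx_design (product_design r s)"
proof -
  have "r i \<le> 1" for i
    using member_le_sum[of i UNIV r] r_pos sum_r by (auto intro: less_imp_le)
  moreover have "s k \<le> 1" for k
    using member_le_sum[of k UNIV s] s_pos sum_s by (auto intro: less_imp_le)
  ultimately have "0 \<le> r i * s k \<and> r i * s k \<le> 1" for i k
    using r_pos[of i] s_pos[of k] by (simp add: mult_le_one)
  moreover have "(\<Sum>i\<in>UNIV. \<Sum>k\<in>UNIV. r i * s k) = 1"
    by (simp add: sum_product[symmetric] sum_r sum_s)
  ultimately show ?thesis
    using s_pos by (simp add: approx_design_def block_size_product) (simp add: product_design_def)
qed

lemma M_mat_product:
  "M_mat (product_design r s) $ i $ j = (if i = j then r i else 0) - r i * r j"
proof -
  have "(\<Sum>k\<in>UNIV. product_design r s i k * product_design r s j k / s k)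
      = (\<Sum>k\<in>UNIV. r i * r j * s k)"
    using s_pos by (intro sum.cong) (auto simp: product_design_def less_imp_neq[symmetric])
  also have "\<dots> = r i * r j"
    by (simp add: sum_distrib_left[symmetric] sum_s)
  finally show ?thesis
    by (simp add: M_mat_entry block_size_product replication_product)
qed

text \<open>
  The contrast \<open>e\<^sub>j - e\<^sub>0\<close> is the image under \<open>M = diag(r) - r r\<^sup>T\<close> of the vector
  \<open>e\<^sub>j/r\<^sub>j - e\<^sub>0/r\<^sub>0\<close>, since the latter is orthogonal to \<open>r\<close>.
\<close>

lemma feasible_product: "feasible (product_design r s)"
proof -
  let ?M = "M_mat (product_design r s)"
  have "column j (Q_mat :: real ^ 'v ^ 'v option) \<in> span (columns ?M)" for j
  proof -
    have "column j (Q_mat :: real ^ 'v ^ 'v option)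
        = (1 / r (Some j)) *\<^sub>R column (Some j) ?M - (1 / r None) *\<^sub>R column None ?M"
    proof (rule vec_eq_iff[THEN iffD2, rule_format])
      fix i show "column j (Q_mat :: real ^ 'v ^ 'v option) $ i
        = ((1 / r (Some j)) *\<^sub>R column (Some j) ?M - (1 / r None) *\<^sub>R column None ?M) $ i"
        using r_pos[of None] r_pos[of "Some j"]
        by (cases i) (auto simp: column_def Q_mat_def M_mat_product field_simps)
    qed
    moreover have "column l ?M \<in> span (columns ?M)" for l
      by (rule span_base) (auto simp: columns_def)
    ultimately show ?thesis by (simp add: span_diff span_scale)
  qed
  then show ?thesis
    unfolding feasible_def by (intro span_minimal subspace_span) (auto simp: columns_def)
qed

text \<open>The inverse of \<open>diag(r) - r r\<^sup>T\<close> on the test treatments is \<open>diag(1/r) + 1 1\<^sup>T / r\<^sub>0\<close>.\<close>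

lemma diag_N_mat_inv_product:
  "matrix_inv (N_mat (product_design r s)) $ i $ i = 1 / r (Some i) + 1 / r None"
proof -
  let ?N = "N_mat (product_design r s)"
  define B :: "real ^ 'v ^ 'v"
    where "B = (\<chi> i j. (if i = j then 1 / r (Some i) else 0) + 1 / r None)"
  have sum_test: "(\<Sum>i\<in>UNIV. r (Some i)) = 1 - r None"
    using sum_r by (simp add: sum_UNIV_option)
  have "(?N ** B) $ i $ j = (if i = j then 1 else 0)" for i j
  proof -
    have "(?N ** B) $ i $ j = (\<Sum>l\<in>UNIV.
        ((if i = l then r (Some i) else 0) - r (Some i) * r (Some l)) *
        ((if l = j then 1 / r (Some l) else 0) + 1 / r None))"
      by (simp add: matrix_matrix_mult_def N_mat_entry M_mat_product B_def)
    also have "\<dots> = (\<Sum>l\<in>UNIV.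
        (if l = i then r (Some i) * ((if i = j then 1 / r (Some i) else 0) + 1 / r None) else 0)
        - (if l = j then r (Some i) else 0) - r (Some i) / r None * r (Some l))"
      using r_pos by (intro sum.cong) (auto simp: field_simps less_imp_neq[symmetric])
    also have "\<dots> = r (Some i) * ((if i = j then 1 / r (Some i) else 0) + 1 / r None)
        - r (Some i) - r (Some i) / r None * (1 - r None)"
      by (simp add: sum_subtractf sum_distrib_left[symmetric] sum_divide_distrib[symmetric] sum_test)
    also have "\<dots> = (if i = j then 1 else 0)"
      using r_pos[of None] r_pos[of "Some i"] by (cases "i = j") (auto simp: field_simps)
    finally show ?thesis .
  qed
  then have "?N ** B = mat 1" by (simp add: vec_eq_iff mat_def)
  then have "matrix_inv ?N = B" by (rule matrix_inv_eqI)
  then show ?thesis by (simp add: B_def)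
qed

end

lemma A_optimal_form_properties:
  fixes \<xi> :: "('v::finite, 'd::finite) design"
  defines "q \<equiv> sqrt (real CARD('v))"
  assumes "A_optimal_form \<xi>"
  shows "approx_design \<xi>" "feasible \<xi>" "matrix_inv (N_mat \<xi>) $ i $ i = (q + 1)\<^sup>2"
proof -
  obtain r s where \<xi>: "\<xi> = product_design r s" and s: "\<And>k. s k > 0" "(\<Sum>k\<in>UNIV. s k) = 1"
    and r: "r None = 1 / (q + 1)" "\<And>i. r (Some i) = 1 / (q * (q + 1))"
    using assms(2) unfolding A_optimal_form_def q_def by blast
  have q: "q > 0" and q2: "real CARD('v) = q * q" by (simp_all add: q_def card_gt_0_iff)
  have "0 < r i" for i using q by (cases i) (simp_all add: r)
  moreover have "(\<Sum>i\<in>UNIV. r i) = 1"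
  proof -
    have "(\<Sum>i\<in>UNIV. r i) = 1 / (q + 1) + q * q / (q * (q + 1))"
      by (simp add: sum_UNIV_option r q2)
    also have "\<dots> = (1 + q) / (q + 1)"
      using q by (simp add: add_divide_distrib)
    finally show ?thesis using q by simp
  qed
  ultimately interpret positive_product_design r s
    using s by unfold_locales auto
  show "approx_design \<xi>" "feasible \<xi>"
    unfolding \<xi> by (rule approx_design_product feasible_product)+
  show "matrix_inv (N_mat \<xi>) $ i $ i = (q + 1)\<^sup>2"
    unfolding \<xi> diag_N_mat_inv_product using q by (simp add: r power2_eq_square algebra_simps)
qed

lemma A_optimal_form_exists: "\<exists>\<xi> :: ('v::finite, 'd::finite) design. A_optimal_form \<xi>"
proof -
  let ?q = "sqrt (real CARD('v))"
  let ?r = "\<lambda>i :: 'v option. case i of None \<Rightarrow> 1 / (?q + 1) | Some _ \<Rightarrow> 1 / (?q * (?q + 1))"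
  let ?s = "\<lambda>_ :: 'd. 1 / real CARD('d)"
  have "A_optimal_form (product_design ?r ?s)"
    unfolding A_optimal_form_def
    by (intro exI[of _ ?r] exI[of _ ?s]) (simp add: card_gt_0_iff)
  then show ?thesis by blast
qed

theorem theorem5:
  fixes \<xi> :: "('v::finite, 'd::finite) design"
  assumes "A_optimal \<xi> \<or> A_optimal_form \<xi>"
  shows "R_optimal \<xi>"
proof -
  define q where "q = sqrt (real CARD('v))"
  have "approx_design \<xi> \<and> feasible \<xi> \<and> R_criterion \<xi> \<le> ((q + 1)\<^sup>2) ^ CARD('v)"
    using assms
  proof
    assume A: "A_optimal \<xi>"
    then have \<xi>: "approx_design \<xi>" "feasible \<xi>" by (simp_all add: A_optimal_def)
    obtain \<eta> :: "('v, 'd) design" where "A_optimal_form \<eta>"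
      using A_optimal_form_exists by blast
    note \<eta> = A_optimal_form_properties[OF this, folded q_def]
    have "A_criterion \<xi> \<le> A_criterion \<eta>"
      using A \<eta>(1,2) by (simp add: A_optimal_def)
    also have "A_criterion \<eta> = real CARD('v) * (q + 1)\<^sup>2"
      by (simp add: A_criterion_def trace_def \<eta>(3))
    finally have "R_criterion \<xi> \<le> ((q + 1)\<^sup>2) ^ CARD('v)"
      unfolding R_criterion_def A_criterion_def trace_def
      using diag_N_mat_inv(1)[OF \<xi>] by (intro prod_le_power_of_sum_le) (auto intro: less_imp_le)
    then show ?thesis using \<xi> by simp
  next
    assume "A_optimal_form \<xi>"
    note \<xi> = A_optimal_form_properties[OF this, folded q_def]
    show ?thesis by (simp add: \<xi>(1,2)) (simp add: R_criterion_def \<xi>(3))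
  qed
  moreover have "((q + 1)\<^sup>2) ^ CARD('v) \<le> R_criterion \<eta>"
    if "approx_design \<eta>" "feasible \<eta>" for \<eta> :: "('v, 'd) design"
    using R_criterion_ge[OF that] by (simp add: q_def)
  ultimately show ?thesis
    unfolding R_optimal_def by (meson order_trans)
qed

end
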